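(* Let $t$ be a positive integer and $Q_t=\{1,3,5,\dots,2t-1\}\setminus\{t,t+1\}$. A self-conjugate partition $\lambda$ belongs to $\mathcal{DS}(t)$ if and only if $MD(\lambda)$ satisfies all of the following: (i) $MD(\lambda)\subseteq Q_t$; (ii) if $h_1,h_2\in MD(\lambda)$ and $h_1>h_2$, then $h_1-h_2\ge4$; (iii) if $h_1,h_2\in MD(\lambda)$, then $h_1+h_2\ne 2t$ and $h_1+h_2\ne 2t+2$.
   Context: Hook length of box $(i,j)$ of a Young diagram: number of boxes to its right in row $i$, plus number below it in column $j$, plus one. A partition is a $t$-core if no hook length is divisible by $t$; a $(t,t+1)$-core if it is both a $t$-core and a $(t+1)$-core. Self-conjugate: Young diagram symmetric about the main diagonal. $s(\lambda)$ is the largest $s$ such that $\lambda$ has at least $s$ parts $\ge s$. $MD(\lambda)$ is the set of hook lengths of the main-diagonal boxes $(i,i)$, $1\le i\le s(\lambda)$ ($MD(\emptyset)=\emptyset$). $\mathcal{DS}(t)$ is the set of self-conjugate $(t,t+1)$-core partitions whose first $s(\lambda)$ parts are pairwise distinct, including the empty partition. *)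

theory Defs
  imports Main
begin

definition is_partition :: "nat list \<Rightarrow> bool" where
  "is_partition p \<longleftrightarrow> sorted_wrt (\<ge>) p \<and> 0 \<notin> set p"

text \<open>Boxes are pairs (row, column), both counted from 1; list positions count from 0.\<close>

definition young :: "nat list \<Rightarrow> (nat \<times> nat) set" where
  "young p = {(i, j). 1 \<le> i \<and> i \<le> length p \<and> 1 \<le> j \<and> j \<le> p ! (i - 1)}"

definition hook :: "nat list \<Rightarrow> nat \<Rightarrow> nat \<Rightarrow> nat" where
  "hook p i j =
     card {j'. j < j' \<and> (i, j') \<in> young p} + card {i'. i < i' \<and> (i', j) \<in> young p} + 1"

definition is_core :: "nat \<Rightarrow> nat list \<Rightarrow> bool" where
  "is_core t p \<longleftrightarrow> (\<forall>(i, j) \<in> young p. \<not> t dvd hook p i j)"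

definition self_conjugate :: "nat list \<Rightarrow> bool" where
  "self_conjugate p \<longleftrightarrow> (\<forall>i j. (i, j) \<in> young p \<longleftrightarrow> (j, i) \<in> young p)"

definition durfee :: "nat list \<Rightarrow> nat" where
  "durfee p = Max {s. s \<le> length (filter (\<lambda>x. s \<le> x) p)}"

definition MD :: "nat list \<Rightarrow> nat set" where
  "MD p = {hook p i i | i. 1 \<le> i \<and> i \<le> durfee p}"

definition DS :: "nat \<Rightarrow> nat list set" where
  "DS t = {p. is_partition p \<and> self_conjugate p \<and> is_core t p \<and> is_core (t + 1) p
              \<and> distinct (take (durfee p) p)}"

definition Q :: "nat \<Rightarrow> nat set" where
  "Q t = {h. odd h \<and> 1 \<le> h \<and> h \<le> 2 * t - 1} - {t, t + 1}"

text \<open>The set defining \<^const>\<open>durfee\<close> is finite and nonempty, so its maximum is attained.\<close>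

lemma durfee_set_finite: "finite {s. s \<le> length (filter (\<lambda>x. s \<le> x) p)}"
  by (rule finite_subset[of _ "{..length p}"])
     (auto intro: order_trans[OF _ length_filter_le])

lemma durfee_Nil: "durfee [] = 0"
  by (simp add: durfee_def)

lemma MD_Nil: "MD [] = {}"
  by (auto simp: MD_def durfee_Nil)

lemma Nil_in_DS: "[] \<in> DS t"
  by (auto simp: DS_def is_partition_def self_conjugate_def is_core_def young_def)

end

theory Submission
  imports Defs
begin

text \<open>
  Encode a self-conjugate partition by the odd integers \<open>b\<^sub>i = 2 (\<lambda>\<^sub>i - i) + 1\<close>, \<open>i \<ge> 1\<close>. The
  positive ones are the main diagonal hook lengths, the hook length of the box \<open>(i, j)\<close> is
  \<open>(b\<^sub>i + b\<^sub>j) / 2\<close>, and of two opposite odd integers exactly one occurs in the sequence.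
  Hence the diagonal hook lengths alone decide whether \<open>\<lambda>\<close> is a \<open>t\<close>-core: no two of them may add
  up to a multiple of \<open>2 t\<close>, and \<open>h > 2 t\<close> forces \<open>h - 2 t\<close>.
  Distinctness of the first \<open>s(\<lambda>)\<close> parts says that diagonal hook lengths differ by at least 4.
  So for a \<open>(t, t + 1)\<close>-core they cannot exceed \<open>2 t\<close>: any \<open>h > 2 t + 2\<close> would
  force two of them at distance 2, and \<open>h = 2 t + 1\<close> would force 1, where \<open>h + 1 = 2 (t + 1)\<close>.
\<close>

section \<open>Parts and the Durfee square\<close>

definition part :: "nat list \<Rightarrow> nat \<Rightarrow> nat" where
  "part p i = (if 1 \<le> i \<and> i \<le> length p then p ! (i - 1) else 0)"

lemma part_Suc: "i < length p \<Longrightarrow> part p (Suc i) = p ! i"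
  by (simp add: part_def)

lemma part_Cons_Suc_Suc: "part (x # p) (Suc (Suc i)) = part p (Suc i)"
  by (simp add: part_def)

lemma mem_young_iff_part: "(i, j) \<in> young p \<longleftrightarrow> 1 \<le> i \<and> 1 \<le> j \<and> j \<le> part p i"
  by (auto simp: young_def part_def)

lemma part_antimono:
  assumes "is_partition p" "1 \<le> i" "i \<le> j"
  shows "part p j \<le> part p i"
proof (cases "i = j \<or> length p < j")
  case False
  then have "i - 1 < j - 1" "j - 1 < length p" using assms by auto
  then have "p ! (j - 1) \<le> p ! (i - 1)"
    using assms(1) unfolding is_partition_def sorted_wrt_iff_nth_less by blast
  then show ?thesis using assms False by (simp add: part_def)
qed (auto simp: part_def)

lemma Suc_le_length_filter_iff_part:
  assumes "is_partition p" "1 \<le> s"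
  shows "Suc k \<le> length (filter (\<lambda>x. s \<le> x) p) \<longleftrightarrow> s \<le> part p (Suc k)"
  using assms(1)
proof (induction p arbitrary: k)
  case Nil
  then show ?case using assms(2) by (simp add: part_def)
next
  case (Cons x p)
  have p: "is_partition p" using Cons.prems by (simp add: is_partition_def)
  have part_1: "part (x # p) (Suc 0) = x" by (simp add: part_def)
  show ?case
  proof (cases "s \<le> x")
    case True
    then show ?thesis
      using Cons.IH[OF p] part_1 by (cases k) (simp_all add: part_Cons_Suc_Suc)
  next
    case False
    then have "filter (\<lambda>x. s \<le> x) p = []"
      using Cons.prems by (auto simp: is_partition_def filter_empty_conv)
    moreover have "part (x # p) (Suc k) < s"
      using part_antimono[OF Cons.prems, of "Suc 0" "Suc k"] part_1 False by simp
    ultimately show ?thesis using False by simp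
  qed
qed

lemma durfee_le_length_filter: "durfee p \<le> length (filter (\<lambda>x. durfee p \<le> x) p)"
proof -
  have "durfee p \<in> {s. s \<le> length (filter (\<lambda>x. s \<le> x) p)}"
    unfolding durfee_def by (rule Max_in[OF durfee_set_finite]) auto
  then show ?thesis by simp
qed

lemma durfee_le_length: "durfee p \<le> length p"
  using durfee_le_length_filter length_filter_le by (rule order_trans)

lemma le_durfee_iff_part:
  assumes "is_partition p" "1 \<le> i"
  shows "i \<le> durfee p \<longleftrightarrow> i \<le> part p i"
proof
  assume le: "i \<le> durfee p"
  then have "durfee p \<le> part p (durfee p)"
    using durfee_le_length_filter[of p] assms(2)
      Suc_le_length_filter_iff_part[OF assms(1), of "durfee p" "durfee p - 1"] by simp
  then show "i \<le> part p i" using part_antimono[OF assms le] le by linarith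
next
  assume "i \<le> part p i"
  then have "i \<le> length (filter (\<lambda>x. i \<le> x) p)"
    using Suc_le_length_filter_iff_part[OF assms, of "i - 1"] assms(2) by simp
  then show "i \<le> durfee p"
    unfolding durfee_def using Max_ge[OF durfee_set_finite] by simp
qed

lemma distinct_take_iff_part_less:
  assumes "is_partition p" "n \<le> length p"
  shows "distinct (take n p) \<longleftrightarrow> (\<forall>i j. 1 \<le> i \<longrightarrow> i < j \<longrightarrow> j \<le> n \<longrightarrow> part p j < part p i)"
proof
  assume dist: "distinct (take n p)"
  show "\<forall>i j. 1 \<le> i \<longrightarrow> i < j \<longrightarrow> j \<le> n \<longrightarrow> part p j < part p i"
  proof (intro allI impI)
    fix i j :: nat
    assume ij: "1 \<le> i" "i < j" "j \<le> n"
    then have "take n p ! (i - 1) \<noteq> take n p ! (j - 1)"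
      using dist assms(2) by (subst nth_eq_iff_index_eq) auto
    then have "part p i \<noteq> part p j" using ij assms(2) by (simp add: part_def)
    then show "part p j < part p i" using part_antimono[OF assms(1), of i j] ij by simp
  qed
next
  assume less: "\<forall>i j. 1 \<le> i \<longrightarrow> i < j \<longrightarrow> j \<le> n \<longrightarrow> part p j < part p i"
  have "p ! j < p ! i" if "i < j" "j < n" for i j
    using less[rule_format, of "Suc i" "Suc j"] that assms(2) by (simp add: part_Suc)
  then show "distinct (take n p)"
    by (fastforce simp: distinct_conv_nth neq_iff)
qed

section \<open>Beads of a self-conjugate partition\<close>

definition bead :: "nat list \<Rightarrow> nat \<Rightarrow> int" where
  "bead p i = 2 * (int (part p i) - int i) + 1"

definition beads :: "nat list \<Rightarrow> int set" where
  "beads p = bead p ` {1..}"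

lemma odd_beads: "x \<in> beads p \<Longrightarrow> odd x"
  by (auto simp: beads_def bead_def)

lemma bead_less_iff:
  assumes "is_partition p" "1 \<le> i" "1 \<le> j"
  shows "bead p j < bead p i \<longleftrightarrow> i < j"
  using part_antimono[OF assms(1), of i j] part_antimono[OF assms(1), of j i] assms
  by (cases i j rule: linorder_cases) (auto simp: bead_def)

lemma bead_pos_iff_le_durfee:
  assumes "is_partition p" "1 \<le> i"
  shows "0 < bead p i \<longleftrightarrow> i \<le> durfee p"
  using le_durfee_iff_part[OF assms] by (auto simp: bead_def)

lemma self_conjugate_le_part_iff:
  assumes "self_conjugate p" "1 \<le> i" "1 \<le> j"
  shows "j \<le> part p i \<longleftrightarrow> i \<le> part p j"
  using assms unfolding self_conjugate_def mem_young_iff_part by blast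

lemma bead_add_pos_iff_mem_young:
  assumes "self_conjugate p" "1 \<le> i" "1 \<le> j"
  shows "0 < bead p i + bead p j \<longleftrightarrow> (i, j) \<in> young p"
  using self_conjugate_le_part_iff[OF assms] assms by (auto simp: bead_def mem_young_iff_part)

lemma bead_add_neq_0:
  assumes "self_conjugate p" "1 \<le> i" "1 \<le> j"
  shows "bead p i + bead p j \<noteq> 0"
  using self_conjugate_le_part_iff[OF assms] by (simp add: bead_def) linarith

lemma double_hook_eq_bead_add:
  assumes "self_conjugate p" "(i, j) \<in> young p"
  shows "2 * int (hook p i j) = bead p i + bead p j"
proof -
  have ij: "1 \<le> i" "1 \<le> j" "j \<le> part p i" using assms(2) by (auto simp: mem_young_iff_part)
  then have ji: "i \<le> part p j" using self_conjugate_le_part_iff[OF assms(1)] by simp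
  have arm: "{j'. j < j' \<and> (i, j') \<in> young p} = {j<..part p i}"
    using ij by (auto simp: mem_young_iff_part)
  have leg: "{i'. i < i' \<and> (i', j) \<in> young p} = {i<..part p j}"
    using ij self_conjugate_le_part_iff[OF assms(1) _ ij(2)] by (auto simp: mem_young_iff_part)
  have "hook p i j = (part p i - j) + (part p j - i) + 1"
    by (simp add: hook_def arm leg)
  then show ?thesis using ij(3) ji by (simp add: bead_def)
qed

lemma ex_bead_eq_or_uminus:
  fixes d :: nat
  assumes "self_conjugate p"
  shows "\<exists>i\<ge>1. bead p i = 2 * int d + 1 \<or> bead p i = - (2 * int d + 1)"
proof -
  \<comment> \<open>\<open>k\<close> is the number of boxes on the diagonal \<open>j - i = d + 1\<close>.\<close>
  have "part p (Suc (length p)) \<le> length p + Suc d" by (simp add: part_def)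
  then obtain k where k: "part p (Suc k) \<le> k + Suc d"
    and before: "\<forall>i<k. \<not> part p (Suc i) \<le> i + Suc d"
    using ex_least_nat_le[of "\<lambda>k. part p (Suc k) \<le> k + Suc d" "length p"] by blast
  show ?thesis
  proof (cases "part p (Suc k) = k + Suc d")
    case True
    then have "bead p (Suc k) = 2 * int d + 1" by (simp add: bead_def)
    then show ?thesis by (intro exI[of _ "Suc k"]) simp
  next
    case False
    define j where "j = k + Suc d"
    have "\<not> Suc k \<le> part p j"
      using self_conjugate_le_part_iff[OF assms, of "Suc k" j] k False by (simp add: j_def)
    moreover have "k \<le> part p j"
    proof (cases k)
      case (Suc i)
      then have "j \<le> part p k" using before by (auto simp: j_def)
      then show ?thesis using self_conjugate_le_part_iff[OF assms, of k j] Suc by (simp add: j_def)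
    qed simp
    ultimately have "part p j = k" by simp
    then have "bead p j = - (2 * int d + 1)" by (simp add: bead_def j_def)
    then show ?thesis by (intro exI[of _ j]) (simp add: j_def)
  qed
qed

lemma uminus_mem_beads_iff:
  assumes "self_conjugate p" "odd x"
  shows "- x \<in> beads p \<longleftrightarrow> x \<notin> beads p"
proof
  assume "- x \<in> beads p"
  then show "x \<notin> beads p" using bead_add_neq_0[OF assms(1)] by (force simp: beads_def)
next
  assume x: "x \<notin> beads p"
  have "odd \<bar>x\<bar>" using assms(2) by simp
  then obtain c where c: "\<bar>x\<bar> = 2 * c + 1" by (rule oddE)
  then have "2 * int (nat c) + 1 = \<bar>x\<bar>" by linarith
  then obtain i where "i \<ge> 1" "bead p i = \<bar>x\<bar> \<or> bead p i = - \<bar>x\<bar>"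
    using ex_bead_eq_or_uminus[OF assms(1), of "nat c"] by auto
  then have "bead p i \<in> beads p" "bead p i = x \<or> bead p i = - x" by (auto simp: beads_def)
  then show "- x \<in> beads p" using x by auto
qed

lemma is_core_iff_beads:
  assumes "self_conjugate p"
  shows "is_core t p \<longleftrightarrow>
    (\<forall>x \<in> beads p. \<forall>y \<in> beads p. 0 < x + y \<longrightarrow> \<not> 2 * int t dvd x + y)"
proof -
  have "t dvd hook p i j \<longleftrightarrow> 2 * int t dvd bead p i + bead p j" if "(i, j) \<in> young p" for i j
    using double_hook_eq_bead_add[OF assms that, symmetric] by simp
  then show ?thesis
    using bead_add_pos_iff_mem_young[OF assms]
    by (fastforce simp: is_core_def beads_def mem_young_iff_part)
qed

section \<open>Main diagonal hook lengths\<close>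

lemma mem_MD_iff_beads:
  assumes "is_partition p" "self_conjugate p"
  shows "h \<in> MD p \<longleftrightarrow> 0 < h \<and> int h \<in> beads p"
proof -
  have diag: "int (hook p i i) = bead p i" if "1 \<le> i" "i \<le> durfee p" for i
    using that le_durfee_iff_part[OF assms(1) that(1)] double_hook_eq_bead_add[OF assms(2), of i i]
    by (simp add: mem_young_iff_part)
  show ?thesis
  proof
    assume "h \<in> MD p"
    then obtain i where "h = hook p i i" "1 \<le> i" "i \<le> durfee p" by (auto simp: MD_def)
    then show "0 < h \<and> int h \<in> beads p"
      using diag[of i] by (auto simp: hook_def beads_def)
  next
    assume "0 < h \<and> int h \<in> beads p"
    then obtain i where i: "0 < h" "1 \<le> i" "bead p i = int h" by (auto simp: beads_def)
    then have "i \<le> durfee p" using bead_pos_iff_le_durfee[OF assms(1), of i] by simp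
    then show "h \<in> MD p" using diag[of i] i by (auto simp: MD_def)
  qed
qed

lemma odd_MD:
  assumes "is_partition p" "self_conjugate p" "h \<in> MD p"
  shows "odd h"
  using assms odd_beads[of "int h" p] by (simp add: mem_MD_iff_beads)

definition separated :: "nat \<Rightarrow> nat set \<Rightarrow> bool" where
  "separated d D \<longleftrightarrow> (\<forall>a \<in> D. \<forall>b \<in> D. a > b \<longrightarrow> a - b \<ge> d)"

lemma separated_MD_iff_bead:
  assumes "is_partition p" "self_conjugate p"
  shows "separated d (MD p) \<longleftrightarrow>
    (\<forall>i j. 1 \<le> i \<longrightarrow> i < j \<longrightarrow> j \<le> durfee p \<longrightarrow> int d \<le> bead p i - bead p j)"
proof
  assume sep: "separated d (MD p)"
  show "\<forall>i j. 1 \<le> i \<longrightarrow> i < j \<longrightarrow> j \<le> durfee p \<longrightarrow> int d \<le> bead p i - bead p j"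
  proof (intro allI impI)
    fix i j :: nat
    assume ij: "1 \<le> i" "i < j" "j \<le> durfee p"
    have pos: "0 < bead p i" "0 < bead p j"
      using bead_pos_iff_le_durfee[OF assms(1)] ij by simp_all
    have "nat (bead p i) \<in> MD p" "nat (bead p j) \<in> MD p"
      using pos ij by (auto simp: mem_MD_iff_beads[OF assms] beads_def)
    moreover have less: "nat (bead p j) < nat (bead p i)"
      using bead_less_iff[OF assms(1), of i j] ij pos by simp
    ultimately have "d \<le> nat (bead p i) - nat (bead p j)"
      using sep by (simp add: separated_def)
    then show "int d \<le> bead p i - bead p j"
      using pos less by linarith
  qed
next
  assume gap: "\<forall>i j. 1 \<le> i \<longrightarrow> i < j \<longrightarrow> j \<le> durfee p \<longrightarrow> int d \<le> bead p i - bead p j"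
  show "separated d (MD p)"
    unfolding separated_def
  proof (intro ballI impI)
    fix a b
    assume "a \<in> MD p" "b \<in> MD p" "a > b"
    then obtain i j where ij: "1 \<le> i" "bead p i = int a" "1 \<le> j" "bead p j = int b" "0 < b"
      by (auto simp: mem_MD_iff_beads[OF assms] beads_def)
    have "i < j" using bead_less_iff[OF assms(1) ij(1,3)] ij \<open>a > b\<close> by simp
    moreover have "j \<le> durfee p" using bead_pos_iff_le_durfee[OF assms(1) ij(3)] ij by simp
    ultimately have "int d \<le> int a - int b" using gap ij by fastforce
    then show "a - b \<ge> d" by linarith
  qed
qed

lemma distinct_take_durfee_iff_separated_MD:
  assumes "is_partition p" "self_conjugate p"
  shows "distinct (take (durfee p) p) \<longleftrightarrow> separated 4 (MD p)"
  unfolding distinct_take_iff_part_less[OF assms(1) durfee_le_length] separated_MD_iff_bead[OF assms]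
proof (intro iffI allI impI)
  fix i j :: nat
  assume "\<forall>i j. 1 \<le> i \<longrightarrow> i < j \<longrightarrow> j \<le> durfee p \<longrightarrow> part p j < part p i"
    and ij: "1 \<le> i" "i < j" "j \<le> durfee p"
  then have "part p j < part p i" by blast
  then show "int 4 \<le> bead p i - bead p j" using ij by (simp add: bead_def)
next
  fix i j :: nat
  assume "\<forall>i j. 1 \<le> i \<longrightarrow> i < j \<longrightarrow> j \<le> durfee p \<longrightarrow> int 4 \<le> bead p i - bead p j"
    and ij: "1 \<le> i" "i < j" "j \<le> durfee p"
  then have "int 4 \<le> bead p i - bead p (Suc i)" by simp
  then have "part p (Suc i) < part p i" by (simp add: bead_def)
  then show "part p j < part p i" using part_antimono[OF assms(1), of "Suc i" j] ij by simp
qed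

section \<open>Cores in terms of the main diagonal\<close>

definition core_diagonal :: "nat \<Rightarrow> nat set \<Rightarrow> bool" where
  "core_diagonal t D \<longleftrightarrow>
    (\<forall>h \<in> D. 2 * t < h \<longrightarrow> h - 2 * t \<in> D) \<and> (\<forall>a \<in> D. \<forall>b \<in> D. \<not> 2 * t dvd a + b)"

lemma core_diagonal_diff_mem:
  assumes "core_diagonal t D" "h \<in> D" "2 * t < h"
  shows "h - 2 * t \<in> D"
  using assms by (simp add: core_diagonal_def)

lemma core_diagonal_not_dvd_add:
  assumes "core_diagonal t D" "a \<in> D" "b \<in> D"
  shows "\<not> 2 * t dvd a + b"
  using assms by (simp add: core_diagonal_def)

lemma core_diagonal_descend:
  assumes "core_diagonal t D" "g + 2 * t * m \<in> D" "0 < g"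
  shows "g \<in> D"
  using assms(2)
proof (induction m)
  case (Suc m)
  have "g + 2 * t * Suc m - 2 * t \<in> D"
    using assms(3) by (intro core_diagonal_diff_mem[OF assms(1) Suc.prems]) simp
  then show ?case by (intro Suc.IH) (simp add: algebra_simps)
qed simp

lemma core_diagonal_MD:
  assumes "is_partition p" "self_conjugate p" "is_core t p"
  shows "core_diagonal t (MD p)"
  unfolding core_diagonal_def
proof (intro conjI ballI impI)
  fix a b
  assume "a \<in> MD p" "b \<in> MD p"
  then have "int a \<in> beads p" "int b \<in> beads p" "0 < int a + int b"
    by (auto simp: mem_MD_iff_beads[OF assms(1,2)])
  then have "\<not> 2 * int t dvd int a + int b"
    using assms(3) unfolding is_core_iff_beads[OF assms(2)] by blast
  then show "\<not> 2 * t dvd a + b"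
    by (metis of_nat_add of_nat_dvd_iff of_nat_mult of_nat_numeral)
next
  fix h
  assume h: "h \<in> MD p" and big: "2 * t < h"
  have bead: "int h \<in> beads p" using h by (simp add: mem_MD_iff_beads[OF assms(1,2)])
  show "h - 2 * t \<in> MD p"
  proof (cases "t = 0")
    case False
    have "2 * int t - int h \<notin> beads p"
      using bead False assms(3) unfolding is_core_iff_beads[OF assms(2)] by force
    moreover have "odd (int h - 2 * int t)" using odd_beads[OF bead] by simp
    ultimately have "int h - 2 * int t \<in> beads p"
      using uminus_mem_beads_iff[OF assms(2), of "int h - 2 * int t"] by simp
    then show ?thesis
      using big by (simp add: mem_MD_iff_beads[OF assms(1,2)] of_nat_diff)
  qed (use h in simp)
qed

lemma core_diagonal_MD_not_dvd_bead_add_negative: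
  assumes "is_partition p" "self_conjugate p" "core_diagonal t (MD p)"
    and "x \<in> beads p" "y \<in> beads p" "y < 0" "0 < x + y"
  shows "\<not> 2 * int t dvd x + y"
proof
  \<comment> \<open>Descending from \<open>x\<close> in steps of \<open>2 t\<close> would reach \<open>- y\<close>, which is not a bead.\<close>
  assume "2 * int t dvd x + y"
  then have "int (2 * t) dvd int (nat (x + y))" using assms(7) by simp
  then have "2 * t dvd nat (x + y)" by (simp only: of_nat_dvd_iff)
  then obtain m where m: "nat (x + y) = 2 * t * m" by (rule dvdE)
  define g where "g = nat (- y)"
  have g: "0 < g" "int g = - y" using assms(6) by (simp_all add: g_def)
  have "int (g + 2 * t * m) = x" using m g assms(7) by linarith
  then have "g + 2 * t * m \<in> MD p"
    using assms(4) g(1) by (simp add: mem_MD_iff_beads[OF assms(1,2)])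
  then have "g \<in> MD p" using core_diagonal_descend[OF assms(3)] g(1) by blast
  then have "- y \<in> beads p" using g(2) by (simp add: mem_MD_iff_beads[OF assms(1,2)])
  then show False
    using uminus_mem_beads_iff[OF assms(2) odd_beads[OF assms(5)]] assms(5) by simp
qed

lemma is_core_if_core_diagonal_MD:
  assumes "is_partition p" "self_conjugate p" "core_diagonal t (MD p)"
  shows "is_core t p"
  unfolding is_core_iff_beads[OF assms(2)]
proof (intro ballI impI notI)
  fix x y
  assume xy: "x \<in> beads p" "y \<in> beads p" "0 < x + y" "2 * int t dvd x + y"
  have "\<not> y < 0"
    using core_diagonal_MD_not_dvd_bead_add_negative[OF assms xy(1,2)] xy(3,4) by blast
  moreover have "\<not> x < 0"
    using core_diagonal_MD_not_dvd_bead_add_negative[OF assms xy(2,1)] xy(3,4)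
    unfolding add.commute[of y x] by blast
  moreover have "x \<noteq> 0" "y \<noteq> 0" using odd_beads xy(1,2) by fastforce+
  ultimately have pos: "0 < x" "0 < y" by simp_all
  then have "nat x \<in> MD p" "nat y \<in> MD p"
    using xy by (simp_all add: mem_MD_iff_beads[OF assms(1,2)])
  then have "\<not> 2 * t dvd nat x + nat y" by (rule core_diagonal_not_dvd_add[OF assms(3)])
  then have "\<not> int (2 * t) dvd int (nat x + nat y)" by (simp only: of_nat_dvd_iff not_False_eq_True)
  then show False using xy(4) pos by simp
qed

theorem is_core_iff_core_diagonal_MD:
  assumes "is_partition p" "self_conjugate p"
  shows "is_core t p \<longleftrightarrow> core_diagonal t (MD p)"
  using core_diagonal_MD[OF assms] is_core_if_core_diagonal_MD[OF assms] by blast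

lemma core_diagonal_iff_add_neq:
  assumes "\<And>h. h \<in> D \<Longrightarrow> 0 < h \<and> h < 2 * t"
  shows "core_diagonal t D \<longleftrightarrow> (\<forall>a \<in> D. \<forall>b \<in> D. a + b \<noteq> 2 * t)"
proof -
  have "2 * t dvd a + b \<longleftrightarrow> a + b = 2 * t" if "a \<in> D" "b \<in> D" for a b
  proof
    assume "2 * t dvd a + b"
    then obtain m where m: "a + b = 2 * t * m" by (rule dvdE)
    have "2 * t * 0 < 2 * t * m" "2 * t * m < 2 * t * 2"
      using assms[OF that(1)] assms[OF that(2)] m by linarith+
    then have "m = 1" by (simp only: mult_less_cancel1) linarith
    then show "a + b = 2 * t" using m by simp
  qed simp
  then show ?thesis using assms by (force simp: core_diagonal_def)
qed

lemma consecutive_core_diagonals_less: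
  assumes "core_diagonal t D" "core_diagonal (t + 1) D" "h \<in> D" "odd h"
    and "separated d D" "2 < d"
  shows "h < 2 * t"
proof -
  have "\<not> 2 * t + 2 < h"
  proof
    assume big: "2 * t + 2 < h"
    then have "h - 2 * t \<in> D" "h - 2 * (t + 1) \<in> D"
      using core_diagonal_diff_mem[OF assms(1,3)] core_diagonal_diff_mem[OF assms(2,3)] by simp_all
    moreover have "h - 2 * (t + 1) < h - 2 * t" using big by simp
    ultimately have "(h - 2 * t) - (h - 2 * (t + 1)) \<ge> d"
      using assms(5) unfolding separated_def by blast
    then show False using assms(6) by simp
  qed
  moreover have "h \<noteq> 2 * t + 1"
  proof
    assume eq: "h = 2 * t + 1"
    then have "1 \<in> D" using core_diagonal_diff_mem[OF assms(1,3)] by simp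
    then have "\<not> 2 * (t + 1) dvd h + 1" by (rule core_diagonal_not_dvd_add[OF assms(2,3)])
    then show False using eq by simp
  qed
  moreover have "h \<noteq> 2 * t" "h \<noteq> 2 * t + 2" using assms(4) by auto
  ultimately show ?thesis by linarith
qed

lemma consecutive_core_diagonals_iff:
  assumes "\<And>h. h \<in> D \<Longrightarrow> odd h" "separated d D" "2 < d"
  shows "core_diagonal t D \<and> core_diagonal (t + 1) D \<longleftrightarrow>
    D \<subseteq> Q t \<and> (\<forall>a \<in> D. \<forall>b \<in> D. a + b \<noteq> 2 * t \<and> a + b \<noteq> 2 * t + 2)"
proof (cases "\<forall>h \<in> D. h < 2 * t")
  case True
  have "core_diagonal t D \<longleftrightarrow> (\<forall>a \<in> D. \<forall>b \<in> D. a + b \<noteq> 2 * t)"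
    using True assms(1) by (intro core_diagonal_iff_add_neq) (auto intro: odd_pos)
  moreover have "core_diagonal (t + 1) D \<longleftrightarrow> (\<forall>a \<in> D. \<forall>b \<in> D. a + b \<noteq> 2 * (t + 1))"
    using True assms(1) by (intro core_diagonal_iff_add_neq) (auto intro: odd_pos less_SucI)
  moreover have "D \<subseteq> Q t" if "\<forall>a \<in> D. \<forall>b \<in> D. a + b \<noteq> 2 * t \<and> a + b \<noteq> 2 * t + 2"
  proof
    fix h
    assume h: "h \<in> D"
    then have "h + h \<noteq> 2 * t" "h + h \<noteq> 2 * t + 2" using that by blast+
    then have "h \<noteq> t" "h \<noteq> t + 1" by simp_all
    then show "h \<in> Q t" using h True assms(1) odd_pos[of h] by (force simp: Q_def)
  qed
  ultimately show ?thesis by auto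
next
  case False
  then have "\<not> D \<subseteq> Q t" by (force simp: Q_def)
  then show ?thesis using False consecutive_core_diagonals_less[OF _ _ _ _ assms(2,3)] assms(1) by blast
qed

theorem theorem2p4:
  fixes t :: nat and p :: "nat list"
  assumes "t > 0" and "is_partition p" and "self_conjugate p"
  shows "p \<in> DS t \<longleftrightarrow>
    MD p \<subseteq> Q t \<and>
    (\<forall>h1 \<in> MD p. \<forall>h2 \<in> MD p. h1 > h2 \<longrightarrow> h1 - h2 \<ge> 4) \<and>
    (\<forall>h1 \<in> MD p. \<forall>h2 \<in> MD p. h1 + h2 \<noteq> 2 * t \<and> h1 + h2 \<noteq> 2 * t + 2)"
proof -
  have "p \<in> DS t \<longleftrightarrow> is_core t p \<and> is_core (t + 1) p \<and> distinct (take (durfee p) p)"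
    using assms(2,3) by (simp add: DS_def)
  also have "\<dots> \<longleftrightarrow>
    (core_diagonal t (MD p) \<and> core_diagonal (t + 1) (MD p)) \<and> separated 4 (MD p)"
    using assms(2,3) is_core_iff_core_diagonal_MD distinct_take_durfee_iff_separated_MD by simp
  also have "\<dots> \<longleftrightarrow>
    (MD p \<subseteq> Q t \<and> (\<forall>h1 \<in> MD p. \<forall>h2 \<in> MD p. h1 + h2 \<noteq> 2 * t \<and> h1 + h2 \<noteq> 2 * t + 2)) \<and>
    separated 4 (MD p)"
    using consecutive_core_diagonals_iff[of "MD p" 4 t] odd_MD[OF assms(2,3)] by auto
  finally show ?thesis unfolding separated_def by blast
qed

end
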